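(* The varieties $\mathbb{RDMP}$ (regular De Morgan p-algebras) and $\mathbb{RDMDBLH}$ (regular De Morgan double Heyting algebras) are term-equivalent to each other. More explicitly: (a) For $\mathbf A = \langle A,\lor,\land,{}^*,{}',0,1\rangle\in \mathbb{RDMP}$, let $\mathbf{A}^{dmdblh} := \langle A, \lor, \land, \to, \leftarrow, {}', 0, 1 \rangle$, where, with $x^+ := x'{}^*{}'$, $x\to y := (x^{*} \lor y^{**})^{**} \land [(x \lor x^{*})^{+} \lor x^{*} \lor y \lor y^{*}]$ and $x\leftarrow y := (x^{+} \land y^{++})^{++} \lor [(x \land x^{+})^{*} \land x^{+} \land y \land y^{+}]$. Then $\mathbf{A}^{dmdblh} \in \mathbb{RDMDBLH}$. (b) For $\mathbf A = \langle A,\lor,\land,\to,\leftarrow,{}',0,1\rangle\in \mathbb{RDMDBLH}$, let $\mathbf{A}^{dmp} := \langle A, \lor, \land, {}^*, {}', 0, 1 \rangle$, where $x^*:=x\to 0$. Then $\mathbf{A}^{dmp} \in \mathbb{RDMP}$. (c) If $\mathbf A \in \mathbb{RDMP}$, then $(\mathbf A^{dmdblh})^{dmp} = \mathbf A$. (d) If $\mathbf A \in \mathbb{RDMDBLH}$, then $(\mathbf A^{dmp})^{dmdblh} = \mathbf A$.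
   Context: A De Morgan algebra is a bounded distributive lattice with a unary operation ${}'$ satisfying $x''\approx x$, $(x\vee y)'\approx x'\wedge y'$, $(x\wedge y)'\approx x'\vee y'$, $0'\approx1$, $1'\approx0$. Write $x'{}^*{}'$ for $((x')^* )'$. $\mathbb{RDMP}$: algebras $\langle A,\vee,\wedge,{}^*,{}',0,1\rangle$ such that $\langle A,\vee,\wedge,{}',0,1\rangle$ is a De Morgan algebra, ${}^*$ is the pseudocomplement ($x^*$ is the largest $z$ with $x\wedge z=0$), and the regularity identity $(x\wedge x'{}^*{}')\vee(y\vee y^* )\approx y\vee y^*$ holds. $\mathbb{RDMDBLH}$: algebras $\langle A,\vee,\wedge,\to,\leftarrow,{}',0,1\rangle$ such that $\langle A,\vee,\wedge,{}',0,1\rangle$ is a De Morgan algebra, $x\to y$ is the largest $z$ with $x\wedge z\le y$, $x\leftarrow y$ is the least $z$ with $y\le x\vee z$, and the same regularity identity holds with $x^*:=x\to0$. Term-equivalence here means precisely the content of (a)-(d). *)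

theory Defs
  imports Main
begin

text \<open>Algebras are records whose universe is the whole (nonempty) type \<open>'a\<close>, so that equality of
  algebras is equality of all their operations.\<close>

record 'a dm =
  join :: "'a \<Rightarrow> 'a \<Rightarrow> 'a" (infixl \<open>\<squnion>\<index>\<close> 65)
  meet :: "'a \<Rightarrow> 'a \<Rightarrow> 'a" (infixl \<open>\<sqinter>\<index>\<close> 70)
  neg :: "'a \<Rightarrow> 'a" (\<open>\<sim>\<index> _\<close> [81] 80)
  zero :: 'a (\<open>\<zero>\<index>\<close>)
  one :: 'a (\<open>\<one>\<index>\<close>)

record 'a dmp = "'a dm" +
  pstar :: "'a \<Rightarrow> 'a"

record 'a dmdblh = "'a dm" +
  imp :: "'a \<Rightarrow> 'a \<Rightarrow> 'a"
  coimp :: "'a \<Rightarrow> 'a \<Rightarrow> 'a"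

definition le :: "('a, 'b) dm_scheme \<Rightarrow> 'a \<Rightarrow> 'a \<Rightarrow> bool" (infix \<open>\<sqsubseteq>\<index>\<close> 50)
  where "x \<sqsubseteq>\<^bsub>A\<^esub> y \<longleftrightarrow> x \<sqinter>\<^bsub>A\<^esub> y = x"

definition lt :: "('a, 'b) dm_scheme \<Rightarrow> 'a \<Rightarrow> 'a \<Rightarrow> bool" (infix \<open>\<sqsubset>\<index>\<close> 50)
  where "x \<sqsubset>\<^bsub>A\<^esub> y \<longleftrightarrow> x \<sqsubseteq>\<^bsub>A\<^esub> y \<and> x \<noteq> y"

locale de_morgan_algebra =
  fixes A :: "('a, 'b) dm_scheme" (structure)
  assumes distrib_lattice: "class.distrib_lattice (meet A) (le A) (lt A) (join A)"
    and bounded_lattice: "class.bounded_lattice (meet A) (le A) (lt A) (join A) \<zero> \<one>"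
    and neg_neg: "\<sim> (\<sim> x) = x"
    and neg_join: "\<sim> (x \<squnion> y) = \<sim> x \<sqinter> \<sim> y"
    and neg_meet: "\<sim> (x \<sqinter> y) = \<sim> x \<squnion> \<sim> y"
    and neg_zero: "\<sim> \<zero> = \<one>"
    and neg_one: "\<sim> \<one> = \<zero>"

text \<open>The operation \<open>x'*'\<close>, for a given unary operation \<open>*\<close>.\<close>

definition plus_of :: "('a, 'b) dm_scheme \<Rightarrow> ('a \<Rightarrow> 'a) \<Rightarrow> 'a \<Rightarrow> 'a"
  where "plus_of A star x = \<sim>\<^bsub>A\<^esub> (star (\<sim>\<^bsub>A\<^esub> x))"

definition regular :: "('a, 'b) dm_scheme \<Rightarrow> ('a \<Rightarrow> 'a) \<Rightarrow> bool"
  where "regular A star \<longleftrightarrow>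
    (\<forall>x y. (x \<sqinter>\<^bsub>A\<^esub> plus_of A star x) \<squnion>\<^bsub>A\<^esub> (y \<squnion>\<^bsub>A\<^esub> star y) = y \<squnion>\<^bsub>A\<^esub> star y)"

locale regular_dm_p_algebra = de_morgan_algebra A
  for A :: "'a dmp" (structure) +
  assumes meet_pstar: "x \<sqinter> pstar A x = \<zero>"
    and pstar_greatest: "x \<sqinter> z = \<zero> \<Longrightarrow> z \<sqsubseteq> pstar A x"
    and regular: "regular A (pstar A)"

locale regular_dm_double_heyting_algebra = de_morgan_algebra A
  for A :: "'a dmdblh" (structure) +
  assumes meet_imp: "x \<sqinter> imp A x y \<sqsubseteq> y"
    and imp_greatest: "x \<sqinter> z \<sqsubseteq> y \<Longrightarrow> z \<sqsubseteq> imp A x y"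
    and join_coimp: "y \<sqsubseteq> x \<squnion> coimp A x y"
    and coimp_least: "y \<sqsubseteq> x \<squnion> z \<Longrightarrow> coimp A x y \<sqsubseteq> z"
    and regular: "regular A (\<lambda>x. imp A x \<zero>)"

definition RDMP :: "'a dmp set"
  where "RDMP = {A. regular_dm_p_algebra A}"

definition RDMDBLH :: "'a dmdblh set"
  where "RDMDBLH = {A. regular_dm_double_heyting_algebra A}"

definition to_dmdblh :: "'a dmp \<Rightarrow> 'a dmdblh"
  where "to_dmdblh A =
    (let s = pstar A; p = plus_of A (pstar A) in
     \<lparr>join = join A, meet = meet A, neg = neg A, zero = zero A, one = one A,
      imp = (\<lambda>x y. s (s (s x \<squnion>\<^bsub>A\<^esub> s (s y))) \<sqinter>\<^bsub>A\<^esub>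
                   (p (x \<squnion>\<^bsub>A\<^esub> s x) \<squnion>\<^bsub>A\<^esub> s x \<squnion>\<^bsub>A\<^esub> y \<squnion>\<^bsub>A\<^esub> s y)),
      coimp = (\<lambda>x y. p (p (p x \<sqinter>\<^bsub>A\<^esub> p (p y))) \<squnion>\<^bsub>A\<^esub>
                     (s (x \<sqinter>\<^bsub>A\<^esub> p x) \<sqinter>\<^bsub>A\<^esub> p x \<sqinter>\<^bsub>A\<^esub> y \<sqinter>\<^bsub>A\<^esub> p y))\<rparr>)"

definition to_dmp :: "'a dmdblh \<Rightarrow> 'a dmp"
  where "to_dmp A =
     \<lparr>join = join A, meet = meet A, neg = neg A, zero = zero A, one = one A,
      pstar = (\<lambda>x. imp A x \<zero>\<^bsub>A\<^esub>)\<rparr>"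

end

theory Submission
  imports Defs
begin

text \<open>The operation \<open>x\<^sup>+ = x'*'\<close> is the dual pseudocomplement. Expanding \<open>x \<sqinter> (x \<rightarrow> y)\<close> by
  distributivity, every summand either vanishes or lies below \<open>y\<close>, except for one below
  \<open>x \<sqinter> x\<^sup>+\<close>, which regularity puts below \<open>y \<squnion> y*\<close>, and \<open>y*\<close> is annihilated by
  \<open>x \<sqinter> (x* \<squnion> y**)**\<close>. Conversely, if \<open>x \<sqinter> z \<sqsubseteq> y\<close>, then \<open>z \<sqsubseteq> (x* \<squnion> y**)**\<close>, and \<open>z\<close> lies below
  the second factor \<open>r\<close> of \<open>x \<rightarrow> y\<close> because \<open>x \<squnion> r = \<one>\<close> and \<open>y \<sqsubseteq> r\<close>.
  The operation \<open>\<leftarrow>\<close> is the De Morgan dual of \<open>\<rightarrow>\<close>. Residuals and pseudocomplements are determined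
  by their universal properties, so the two translations are mutually inverse.\<close>

context de_morgan_algebra
begin

sublocale distrib_lattice "meet A" "le A" "lt A" "join A"
  by (rule distrib_lattice)

sublocale bounded_lattice "meet A" "le A" "lt A" "join A" "\<zero>" "\<one>"
  by (rule bounded_lattice)

lemma neg_le_neg_iff: "\<sim> x \<sqsubseteq> \<sim> y \<longleftrightarrow> y \<sqsubseteq> x"
  by (metis le_iff_inf le_iff_sup neg_join neg_neg sup_commute)

end

context regular_dm_p_algebra
begin

abbreviation star (\<open>_\<^sup>\<star>\<close> [1000] 1000) where "x\<^sup>\<star> \<equiv> pstar A x"
abbreviation plus (\<open>_\<^sup>\<oplus>\<close> [1000] 1000) where "x\<^sup>\<oplus> \<equiv> plus_of A (pstar A) x"

lemma le_pstar_iff: "z \<sqsubseteq> x\<^sup>\<star> \<longleftrightarrow> x \<sqinter> z = \<zero>"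
  by (metis bot_unique inf_mono meet_pstar order_refl pstar_greatest)

lemma pstar_join: "(x \<squnion> y)\<^sup>\<star> = x\<^sup>\<star> \<sqinter> y\<^sup>\<star>"
proof (rule order.antisym)
  show "(x \<squnion> y)\<^sup>\<star> \<sqsubseteq> x\<^sup>\<star> \<sqinter> y\<^sup>\<star>"
    by (metis inf_sup_distrib2 le_inf_iff le_pstar_iff order_refl sup_eq_bot_iff)
  show "x\<^sup>\<star> \<sqinter> y\<^sup>\<star> \<sqsubseteq> (x \<squnion> y)\<^sup>\<star>"
    by (metis inf_le1 inf_le2 inf_sup_distrib2 le_pstar_iff sup_bot_left)
qed

lemma plus_join: "x \<squnion> x\<^sup>\<oplus> = \<one>"
  by (metis meet_pstar neg_meet neg_neg neg_zero plus_of_def)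

text \<open>Three order reversals, by negation, star and negation, compose to one;
  \<open>pstar_join\<close> makes the star antitone.\<close>

lemma plus_antimono: "x \<sqsubseteq> y \<Longrightarrow> y\<^sup>\<oplus> \<sqsubseteq> x\<^sup>\<oplus>"
  by (metis le_iff_sup le_inf_iff neg_le_neg_iff order_refl plus_of_def pstar_join)

lemma meet_plus_le: "x \<sqinter> x\<^sup>\<oplus> \<sqsubseteq> y \<squnion> y\<^sup>\<star>"
  using regular le_iff_sup unfolding regular_def by blast

lemma imp_to_dmdblh:
  "imp (to_dmdblh A) x y =
     (x\<^sup>\<star> \<squnion> y\<^sup>\<star>\<^sup>\<star>)\<^sup>\<star>\<^sup>\<star> \<sqinter> ((x \<squnion> x\<^sup>\<star>)\<^sup>\<oplus> \<squnion> x\<^sup>\<star> \<squnion> y \<squnion> y\<^sup>\<star>)"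
  by (simp add: to_dmdblh_def Let_def)

text \<open>Conjugation by \<open>\<sim>\<close> exchanges \<open>pstar A\<close> with
  \<open>plus_of A (pstar A)\<close> and joins with meets, so it carries one formula to the
  other.\<close>

lemma coimp_to_dmdblh:
  "coimp (to_dmdblh A) x y = \<sim> (imp (to_dmdblh A) (\<sim> x) (\<sim> y))"
  by (simp add: to_dmdblh_def Let_def plus_of_def neg_join neg_meet neg_neg)

text \<open>This residuation law yields both axioms of \<open>imp\<close> at once and, by
  conjugation with \<open>\<sim>\<close>, those of \<open>coimp\<close>.\<close>

lemma le_imp_to_dmdblh_iff: "z \<sqsubseteq> imp (to_dmdblh A) x y \<longleftrightarrow> x \<sqinter> z \<sqsubseteq> y"
proof
  let ?d = "(x\<^sup>\<star> \<squnion> y\<^sup>\<star>\<^sup>\<star>)\<^sup>\<star>\<^sup>\<star>" and ?p = "(x \<squnion> x\<^sup>\<star>)\<^sup>\<oplus>"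
  let ?r = "?p \<squnion> x\<^sup>\<star> \<squnion> y \<squnion> y\<^sup>\<star>"
  have annihilate: "x \<sqinter> ?d \<sqinter> y\<^sup>\<star> = \<zero>"
  proof -
    \<comment> \<open>By \<open>pstar_join\<close> the bound is the meet of the double stars of
      \<open>x\<close> and \<open>y\<^sup>\<star>\<close>, and each element lies below its double
      star.\<close>
    have "x \<sqinter> y\<^sup>\<star> \<sqsubseteq> (x\<^sup>\<star> \<squnion> y\<^sup>\<star>\<^sup>\<star>)\<^sup>\<star>"
      unfolding pstar_join using le_pstar_iff meet_pstar
      by (metis inf_commute inf_mono)
    then have "(x \<sqinter> y\<^sup>\<star>) \<sqinter> ?d = \<zero>"
      by (metis bot_unique inf_mono meet_pstar order_refl)
    then show ?thesis
      by (simp add: ac_simps)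
  qed
  have below: "x \<sqinter> ?d \<sqinter> w \<sqsubseteq> y" if "w \<sqsubseteq> y \<squnion> y\<^sup>\<star>" for w
  proof -
    have "x \<sqinter> ?d \<sqinter> w \<sqsubseteq> x \<sqinter> ?d \<sqinter> (y \<squnion> y\<^sup>\<star>)"
      using that inf_mono by blast
    also have "\<dots> = x \<sqinter> ?d \<sqinter> y"
      by (simp add: inf_sup_distrib1 annihilate)
    finally show ?thesis by simp
  qed
  {
    assume "z \<sqsubseteq> imp (to_dmdblh A) x y"
    then have "x \<sqinter> z \<sqsubseteq> x \<sqinter> (?d \<sqinter> ?r)"
      unfolding imp_to_dmdblh using inf_mono by blast
    \<comment> \<open>Idempotence duplicates \<open>x\<close>, so that \<open>below\<close> can be
      applied to \<open>x \<sqinter> ?r\<close>, where the summand \<open>x\<^sup>\<star>\<close>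
      vanishes.\<close>
    also have "\<dots> = x \<sqinter> ?d \<sqinter> (x \<sqinter> ?r)"
      by (simp add: ac_simps)
    also have "\<dots> \<sqsubseteq> y"
    proof (rule below)
      have "x \<sqinter> ?p \<sqsubseteq> x \<sqinter> x\<^sup>\<oplus>"
        using plus_antimono[of x "x \<squnion> x\<^sup>\<star>"] by (simp add: le_infI2)
      then have "x \<sqinter> ?p \<sqsubseteq> y \<squnion> y\<^sup>\<star>"
        using meet_plus_le order_trans by blast
      then show "x \<sqinter> ?r \<sqsubseteq> y \<squnion> y\<^sup>\<star>"
        by (simp add: inf_sup_distrib1 meet_pstar le_supI1 le_supI2)
    qed
    finally show "x \<sqinter> z \<sqsubseteq> y" .
  }
  {
    assume xz: "x \<sqinter> z \<sqsubseteq> y"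
    \<comment> \<open>For \<open>z \<sqsubseteq> ?d\<close> the aim is that \<open>z\<close> misses
      \<open>x\<^sup>\<star>\<^sup>\<star> \<sqinter>
      y\<^sup>\<star>\<^sup>\<star>\<^sup>\<star>\<close>.\<close>
    have "x \<sqinter> z \<sqinter> y\<^sup>\<star> = \<zero>"
      using xz by (metis bot_unique inf_mono meet_pstar order_refl)
    then have "z \<sqinter> y\<^sup>\<star> \<sqsubseteq> x\<^sup>\<star>"
      by (simp add: le_pstar_iff inf_assoc)
    then have "x\<^sup>\<star>\<^sup>\<star> \<sqinter> (z \<sqinter> y\<^sup>\<star>) = \<zero>"
      by (metis bot_unique inf_commute inf_mono meet_pstar order_refl)
    \<comment> \<open>Since \<open>y\<close> lies below its double star, it misses its triple
      star.\<close>
    moreover have "y\<^sup>\<star>\<^sup>\<star>\<^sup>\<star> \<sqsubseteq> y\<^sup>\<star>"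
      by (metis inf_commute le_pstar_iff order_refl order_trans)
    then have "x\<^sup>\<star>\<^sup>\<star> \<sqinter> (z \<sqinter> y\<^sup>\<star>\<^sup>\<star>\<^sup>\<star>) \<sqsubseteq> x\<^sup>\<star>\<^sup>\<star> \<sqinter> (z \<sqinter> y\<^sup>\<star>)"
      using inf_mono order_refl by blast
    ultimately have "(x\<^sup>\<star>\<^sup>\<star> \<sqinter> y\<^sup>\<star>\<^sup>\<star>\<^sup>\<star>) \<sqinter> z = \<zero>"
      by (simp add: bot_unique ac_simps)
    then have "z \<sqsubseteq> ?d"
      by (simp add: le_pstar_iff pstar_join)
    moreover have "z \<sqsubseteq> ?r"
    proof -
      \<comment> \<open>Joining \<open>x\<close> to the summand \<open>x\<^sup>\<star>\<close> of
        \<open>?r\<close> gives the element whose dual pseudocomplement is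
        \<open>?p\<close>.\<close>
      have "x \<squnion> ?r = \<one>"
      proof -
        have "x \<squnion> ?r = ((x \<squnion> x\<^sup>\<star>) \<squnion> ?p) \<squnion> (y \<squnion> y\<^sup>\<star>)"
          by (simp add: ac_simps)
        then show ?thesis by (simp add: plus_join)
      qed
      then have "z = (x \<sqinter> z) \<squnion> (?r \<sqinter> z)"
        by (metis inf_sup_distrib2 inf_top_left)
      also have "\<dots> \<sqsubseteq> ?r"
        using xz by (simp add: le_supI1 le_supI2)
      finally show ?thesis .
    qed
    ultimately show "z \<sqsubseteq> imp (to_dmdblh A) x y"
      by (simp add: imp_to_dmdblh)
  }
qed

lemma coimp_to_dmdblh_le_iff: "coimp (to_dmdblh A) x y \<sqsubseteq> z \<longleftrightarrow> y \<sqsubseteq> x \<squnion> z"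
proof -
  have "coimp (to_dmdblh A) x y \<sqsubseteq> z \<longleftrightarrow> \<sim> z \<sqsubseteq> imp (to_dmdblh A) (\<sim> x) (\<sim> y)"
    unfolding coimp_to_dmdblh by (metis neg_le_neg_iff neg_neg)
  also have "\<dots> \<longleftrightarrow> \<sim> (x \<squnion> z) \<sqsubseteq> \<sim> y"
    by (simp add: le_imp_to_dmdblh_iff neg_join)
  finally show ?thesis by (simp add: neg_le_neg_iff)
qed

text \<open>Both sides have the same lower bounds \<open>z\<close>, namely those with
  \<open>x \<sqinter> z = \<zero>\<close>.\<close>

lemma imp_to_dmdblh_zero: "imp (to_dmdblh A) x \<zero> = x\<^sup>\<star>"
  by (metis bot_unique le_imp_to_dmdblh_iff le_pstar_iff order.antisym order_refl)

end

lemma reduct_to_dmdblh: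
  "join (to_dmdblh A) = join A" "meet (to_dmdblh A) = meet A" "neg (to_dmdblh A) = neg A"
  "zero (to_dmdblh A) = zero A" "one (to_dmdblh A) = one A"
  by (simp_all add: to_dmdblh_def Let_def)

lemma reduct_to_dmp:
  "join (to_dmp A) = join A" "meet (to_dmp A) = meet A" "neg (to_dmp A) = neg A"
  "zero (to_dmp A) = zero A" "one (to_dmp A) = one A"
  by (simp_all add: to_dmp_def)

lemma pstar_to_dmp: "pstar (to_dmp A) x = imp A x (zero A)"
  by (simp add: to_dmp_def)

lemma le_cong: "meet A = meet B \<Longrightarrow> le A = le B"
  by (simp add: le_def fun_eq_iff)

lemma lt_cong: "meet A = meet B \<Longrightarrow> lt A = lt B"
  by (simp add: lt_def le_def fun_eq_iff)

lemma regular_cong: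
  "join A = join B \<Longrightarrow> meet A = meet B \<Longrightarrow> neg A = neg B \<Longrightarrow> regular A s = regular B s"
  by (simp add: regular_def plus_of_def)

text \<open>\<open>A\<close> and \<open>B\<close> may be records of different types, so the axioms
  are transported along the shared fields.\<close>

lemma de_morgan_algebra_cong:
  assumes "join A = join B" "meet A = meet B" "neg A = neg B" "zero A = zero B" "one A = one B"
  shows "de_morgan_algebra A = de_morgan_algebra B"
  using assms le_cong[OF assms(2)] lt_cong[OF assms(2)] by (simp add: de_morgan_algebra_def)

lemma (in regular_dm_p_algebra) to_dmdblh_in_RDMDBLH: "to_dmdblh A \<in> RDMDBLH"
proof -
  have "de_morgan_algebra (to_dmdblh A)"
    using de_morgan_algebra_axioms
    by (simp add: de_morgan_algebra_cong[of "to_dmdblh A" A] reduct_to_dmdblh)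
  moreover have "le (to_dmdblh A) = le A"
    by (rule le_cong) (simp add: reduct_to_dmdblh)
  moreover have "regular (to_dmdblh A) (pstar A)"
    using regular by (simp add: regular_cong[of "to_dmdblh A" A] reduct_to_dmdblh)
  moreover have "x \<sqinter> imp (to_dmdblh A) x y \<sqsubseteq> y" for x y
    using le_imp_to_dmdblh_iff order_refl by blast
  moreover have "y \<sqsubseteq> x \<squnion> coimp (to_dmdblh A) x y" for x y
    using coimp_to_dmdblh_le_iff order_refl by blast
  ultimately show ?thesis
    by (simp add: RDMDBLH_def regular_dm_double_heyting_algebra_def
        regular_dm_double_heyting_algebra_axioms_def reduct_to_dmdblh
        le_imp_to_dmdblh_iff coimp_to_dmdblh_le_iff imp_to_dmdblh_zero)
qed

lemma (in regular_dm_p_algebra) to_dmp_to_dmdblh: "to_dmp (to_dmdblh A) = A"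
  by (rule dmp.equality)
    (simp_all add: reduct_to_dmp reduct_to_dmdblh pstar_to_dmp imp_to_dmdblh_zero fun_eq_iff)

context regular_dm_double_heyting_algebra
begin

lemma le_imp_iff: "z \<sqsubseteq> imp A x y \<longleftrightarrow> x \<sqinter> z \<sqsubseteq> y"
  by (meson imp_greatest inf_mono meet_imp order_refl order_trans)

lemma coimp_le_iff: "coimp A x y \<sqsubseteq> z \<longleftrightarrow> y \<sqsubseteq> x \<squnion> z"
  by (meson coimp_least join_coimp order_refl order_trans sup_mono)

lemma to_dmp_in_RDMP: "to_dmp A \<in> RDMP"
proof -
  have "de_morgan_algebra (to_dmp A)"
    using de_morgan_algebra_axioms
    by (simp add: de_morgan_algebra_cong[of "to_dmp A" A] reduct_to_dmp)
  moreover have "le (to_dmp A) = le A"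
    by (rule le_cong) (simp add: reduct_to_dmp)
  moreover have "pstar (to_dmp A) = (\<lambda>x. imp A x \<zero>)"
    by (simp add: pstar_to_dmp fun_eq_iff)
  moreover have "regular (to_dmp A) (\<lambda>x. imp A x \<zero>)"
    using regular by (simp add: regular_cong[of "to_dmp A" A] reduct_to_dmp)
  moreover have "x \<sqinter> imp A x \<zero> = \<zero>" for x
    using meet_imp bot_unique by blast
  ultimately show ?thesis
    by (simp add: RDMP_def regular_dm_p_algebra_def regular_dm_p_algebra_axioms_def
        reduct_to_dmp le_imp_iff)
qed

lemma to_dmdblh_to_dmp: "to_dmdblh (to_dmp A) = A"
proof (rule dmdblh.equality)
  interpret P: regular_dm_p_algebra "to_dmp A"
    using to_dmp_in_RDMP by (simp add: RDMP_def)
  have le_eq: "le (to_dmp A) = le A"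
    by (rule le_cong) (simp add: reduct_to_dmp)
  \<comment> \<open>Two elements with the same lower bounds are equal by antisymmetry;
    \<open>coimp\<close> is treated below with upper bounds.\<close>
  have "z \<sqsubseteq> imp (to_dmdblh (to_dmp A)) x y \<longleftrightarrow> z \<sqsubseteq> imp A x y" for x y z
    using P.le_imp_to_dmdblh_iff by (simp add: le_eq reduct_to_dmp le_imp_iff)
  then show "imp (to_dmdblh (to_dmp A)) = imp A"
    by (meson ext order.antisym order_refl)
  have "coimp (to_dmdblh (to_dmp A)) x y \<sqsubseteq> z \<longleftrightarrow> coimp A x y \<sqsubseteq> z" for x y z
    using P.coimp_to_dmdblh_le_iff by (simp add: le_eq reduct_to_dmp coimp_le_iff)
  then show "coimp (to_dmdblh (to_dmp A)) = coimp A"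
    by (meson ext order.antisym order_refl)
qed (simp_all add: reduct_to_dmp reduct_to_dmdblh)

end

theorem corollary2p9:
  shows "(\<forall>A \<in> (RDMP :: 'a dmp set). to_dmdblh A \<in> RDMDBLH)
       \<and> (\<forall>A \<in> (RDMDBLH :: 'a dmdblh set). to_dmp A \<in> RDMP)
       \<and> (\<forall>A \<in> (RDMP :: 'a dmp set). to_dmp (to_dmdblh A) = A)
       \<and> (\<forall>A \<in> (RDMDBLH :: 'a dmdblh set). to_dmdblh (to_dmp A) = A)"
  using regular_dm_p_algebra.to_dmdblh_in_RDMDBLH regular_dm_p_algebra.to_dmp_to_dmdblh
    regular_dm_double_heyting_algebra.to_dmp_in_RDMP
    regular_dm_double_heyting_algebra.to_dmdblh_to_dmp
  unfolding RDMP_def RDMDBLH_def by blast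

end
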